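(* Let $W$ be an $m\times n$ stochastic matrix, not all of whose rows are equal and none of whose columns is identically zero. Let $(r,f)$ be an admissible pair for $W$ with associated $\tilde W$ and $c$, and assume that Algorithm III (see context) generates a sequence converging to some $p^*\in\Omega(r)$ with $p^*_i>r_i$ for all $i$. Then the matrix rate of convergence $R(p^* )$ satisfies $$R(p^* )=I_m-\tilde W\Psi,$$ where $\Psi=(\Psi_{ji})$ is the $n\times m$ matrix $$\Psi_{ji}=\Phi_{ji}(p^* )+p_i^*\,\Phi_{j0}(p^* ),\qquad 1\le j\le n,\ 1\le i\le m,$$ with $$\Phi_{ji}(p)=\frac{p_i\tilde W_{ij}}{f_j+\sum_l p_l\tilde W_{lj}}\ (1\le i\le m),\qquad \Phi_{j0}(p)=\frac{f_j}{f_j+\sum_l p_l\tilde W_{lj}}.$$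
   Context: Vectors are row vectors except that $1_m$, $1_n$ denote the column vectors of ones; $I_m$ is the identity matrix; inequalities between vectors or matrices are entrywise; $W_i$ is the $i$th row of a matrix $W$. A matrix is stochastic if it has nonnegative entries and all row sums equal to 1. $\Omega=\{p\in\mathbf{R}^{1\times m}: p\ge 0,\ p1_m=1\}$ and $\Omega(r)=\{p\in\Omega: p\ge r\}$. Logarithms are natural, $0\log 0=0$, and $H(q)=-\sum_i q_i\log q_i$ for a nonnegative vector $q$. Admissible pair: nonnegative vectors $r$ ($1\times m$) and $f$ ($1\times n$), with $r_+=r1_m$, $f_+=f1_n$, such that $r_+<1$ and $$\tilde W:=(1+f_+)\frac{I_m-1_m r}{1-r_+}W-1_m f\ \ge 0$$ (then $\tilde W$ is stochastic). The associated vector $c$ is $c_i=H(\tilde W_i)-\frac{1+f_+}{1-r_+}H(W_i)$. Algorithm III: choose $p^{(0)}\in\Omega(r)$ with $p^{(0)}_i>0$ for all $i$, and iterate $p^{(t+1)}=M(p^{(t)})$, where for $p$ with positive entries $$M_i(p)=\max\Big\{r_i,\ \alpha\exp\Big(c_i+\sum_j\tilde W_{ij}\log\Phi_{ji}(p)\Big)\Big\},\qquad \Phi_{ji}(p)=\frac{p_i\tilde W_{ij}}{f_j+\sum_l p_l\tilde W_{lj}},$$ and $\alpha=\alpha(p)>0$ is chosen so that $\sum_i M_i(p)=1$ (terms with $\tilde W_{ij}=0$ contribute $0$). A limit $p^*$ with $p_i^*>r_i$ for all $i$ is a fixed point of $M$, and for $p$ in a neighbourhood of $p^*$ in $\mathbf{R}^{1\times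 m}$ one has $$M_i(p)=\frac{\exp(c_i+\sum_j\tilde W_{ij}\log\Phi_{ji}(p))}{\sum_{l=1}^m\exp(c_l+\sum_j\tilde W_{lj}\log\Phi_{jl}(p))}.$$ The matrix rate of convergence is the $m\times m$ matrix $R(p^* )=\partial M(p^* )/\partial p$ of partial derivatives (with $p_1,\dots,p_m$ treated as independent variables), with the row-vector convention: its $(k,i)$ entry is $\partial M_i/\partial p_k$ at $p^*$, so that $p^{(t+1)}-p^*\approx(p^{(t)}-p^* )R(p^* )$. *)

theory Defs
  imports "HOL-Analysis.Analysis"
begin

text \<open>
  Row vectors of length \<open>m\<close> are elements of \<open>real ^ 'm\<close>, and an \<open>m \<times> n\<close> matrix \<open>A\<close> is an element of
  \<open>real ^ 'n ^ 'm\<close>, so that \<open>A $ i\<close> is its \<open>i\<close>-th row. The relation \<open>\<le>\<close> on vectors and matrices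
  is entrywise, but \<open><\<close> is not, so strict entrywise inequalities are written out.
\<close>

definition stochastic :: "real ^ 'n ^ 'm \<Rightarrow> bool" where
  "stochastic A \<longleftrightarrow> 0 \<le> A \<and> (\<forall>i. (\<Sum>j\<in>UNIV. A $ i $ j) = 1)"

definition entry_sum :: "real ^ 'n \<Rightarrow> real" where
  "entry_sum v = (\<Sum>j\<in>UNIV. v $ j)"

definition ones_times :: "real ^ 'n \<Rightarrow> real ^ 'n ^ 'm" \<comment> \<open>the product \<open>1\<^sub>m v\<close>: every row is \<open>v\<close>\<close> where
  "ones_times v = (\<chi> i. v)"

definition prob_simplex :: "(real ^ 'm) set" where
  "prob_simplex = {p. 0 \<le> p \<and> entry_sum p = 1}"

definition prob_simplex_above :: "real ^ 'm \<Rightarrow> (real ^ 'm) set" where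
  "prob_simplex_above r = {p \<in> prob_simplex. r \<le> p}"

text \<open>The convention \<open>0 log 0 = 0\<close> is automatic, since the factor \<open>0\<close> annihilates \<open>ln 0\<close>.\<close>

definition entropy :: "real ^ 'n \<Rightarrow> real" where
  "entropy q = - (\<Sum>j\<in>UNIV. q $ j * ln (q $ j))"

definition W_tilde :: "real ^ 'n ^ 'm \<Rightarrow> real ^ 'm \<Rightarrow> real ^ 'n \<Rightarrow> real ^ 'n ^ 'm" where
  "W_tilde W r f =
     ((1 + entry_sum f) / (1 - entry_sum r)) *\<^sub>R ((mat 1 - ones_times r) ** W) - ones_times f"

definition admissible_pair :: "real ^ 'n ^ 'm \<Rightarrow> real ^ 'm \<Rightarrow> real ^ 'n \<Rightarrow> bool" where
  "admissible_pair W r f \<longleftrightarrow> 0 \<le> r \<and> 0 \<le> f \<and> entry_sum r < 1 \<and> 0 \<le> W_tilde W r f"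

definition c_vec :: "real ^ 'n ^ 'm \<Rightarrow> real ^ 'm \<Rightarrow> real ^ 'n \<Rightarrow> real ^ 'm" where
  "c_vec W r f = (\<chi> i. entropy (W_tilde W r f $ i)
     - (1 + entry_sum f) / (1 - entry_sum r) * entropy (W $ i))"

text \<open>
  The arguments \<open>V\<close> and \<open>f\<close> below stand for \<open>W_tilde W r f\<close> and \<open>f\<close>. The components of
  \<open>Phi V f p\<close> are \<open>\<Phi>\<^sub>j\<^sub>i(p)\<close> with \<open>1 \<le> i \<le> m\<close>; the extra index \<open>i = 0\<close> is covered by \<open>Phi0\<close>.
\<close>

definition Phi :: "real ^ 'n ^ 'm \<Rightarrow> real ^ 'n \<Rightarrow> real ^ 'm \<Rightarrow> real ^ 'm ^ 'n" where
  "Phi V f p = (\<chi> j i. p $ i * V $ i $ j / (f $ j + (\<Sum>l\<in>UNIV. p $ l * V $ l $ j)))"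

definition Phi0 :: "real ^ 'n ^ 'm \<Rightarrow> real ^ 'n \<Rightarrow> real ^ 'm \<Rightarrow> real ^ 'n" where
  "Phi0 V f p = (\<chi> j. f $ j / (f $ j + (\<Sum>l\<in>UNIV. p $ l * V $ l $ j)))"

definition Psi :: "real ^ 'n ^ 'm \<Rightarrow> real ^ 'n \<Rightarrow> real ^ 'm \<Rightarrow> real ^ 'm ^ 'n" where
  "Psi V f p = (\<chi> j i. Phi V f p $ j $ i + p $ i * Phi0 V f p $ j)"

text \<open>
  The exponential in the iteration map. Summands with \<open>V $ i $ j = 0\<close> contribute \<open>0\<close>, as required,
  whatever the value of the logarithm.
\<close>

definition algIII_weight ::
    "real ^ 'n ^ 'm \<Rightarrow> real ^ 'm \<Rightarrow> real ^ 'n \<Rightarrow> real ^ 'm \<Rightarrow> 'm \<Rightarrow> real" where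
  "algIII_weight W r f p i =
     exp (c_vec W r f $ i
       + (\<Sum>j\<in>UNIV. W_tilde W r f $ i $ j * ln (Phi (W_tilde W r f) f p $ j $ i)))"

text \<open>
  The normalizer \<open>\<alpha>(p)\<close> is unique: the sum below is continuous and nondecreasing in \<open>\<alpha>\<close>, equals
  \<open>entry_sum r < 1\<close> at \<open>\<alpha> = 0\<close>, is strictly increasing where it exceeds \<open>entry_sum r\<close>, and is
  unbounded because all weights are positive.
\<close>

definition algIII_alpha ::
    "real ^ 'n ^ 'm \<Rightarrow> real ^ 'm \<Rightarrow> real ^ 'n \<Rightarrow> real ^ 'm \<Rightarrow> real" where
  "algIII_alpha W r f p =
     (THE \<alpha>. 0 < \<alpha> \<and> (\<Sum>i\<in>UNIV. max (r $ i) (\<alpha> * algIII_weight W r f p i)) = 1)"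

definition algIII_map ::
    "real ^ 'n ^ 'm \<Rightarrow> real ^ 'm \<Rightarrow> real ^ 'n \<Rightarrow> real ^ 'm \<Rightarrow> real ^ 'm" where
  "algIII_map W r f p = (\<chi> i. max (r $ i) (algIII_alpha W r f p * algIII_weight W r f p i))"

definition algIII_sequence ::
    "real ^ 'n ^ 'm \<Rightarrow> real ^ 'm \<Rightarrow> real ^ 'n \<Rightarrow> (nat \<Rightarrow> real ^ 'm) \<Rightarrow> bool" where
  "algIII_sequence W r f p \<longleftrightarrow>
     p 0 \<in> prob_simplex_above r \<and> (\<forall>i. 0 < p 0 $ i) \<and> (\<forall>t. p (Suc t) = algIII_map W r f (p t))"

text \<open>
  The restriction of the \<open>i\<close>-th component of \<open>M\<close> to the line through \<open>q\<close> in coordinate direction \<open>k\<close>;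
  its derivative at \<open>0\<close> is the partial derivative \<open>\<partial>M\<^sub>i/\<partial>p\<^sub>k\<close> at \<open>q\<close>. The line leaves the simplex:
  the coordinates are treated as independent variables.
\<close>

definition coord_line ::
    "(real ^ 'm \<Rightarrow> real ^ 'm) \<Rightarrow> real ^ 'm \<Rightarrow> 'm \<Rightarrow> 'm \<Rightarrow> real \<Rightarrow> real" where
  "coord_line M q k i = (\<lambda>t. M (q + t *\<^sub>R axis k 1) $ i)"

text \<open>
  Row-vector convention: the \<open>(k, i)\<close> entry is \<open>\<partial>M\<^sub>i/\<partial>p\<^sub>k\<close>, so this is the transpose of the usual
  Jacobian matrix.
\<close>

definition rate_matrix :: "(real ^ 'm \<Rightarrow> real ^ 'm) \<Rightarrow> real ^ 'm \<Rightarrow> real ^ 'm ^ 'm" where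
  "rate_matrix M q = (\<chi> k i. deriv (coord_line M q k i) 0)"

end

theory Submission
  imports Defs
begin

text \<open>
  Passing to the limit in the iteration shows that \<open>q\<close> is proportional to its own weight vector.
  As \<open>q > r\<close> strictly and the weights are continuous, near \<open>q\<close> every maximum in \<open>M\<close> is attained by
  its second argument, so that \<open>M\<close> is there the quotient of the weights by their sum. The rest is
  logarithmic differentiation.
\<close>

text \<open>As the rows of \<open>W\<close> sum to 1, multiplying by \<open>W\<close> preserves the
  row sums \<open>1 - entry_sum r\<close> of \<open>mat 1 - ones_times r\<close>. The scalar factor
  turns them into \<open>1 + entry_sum f\<close>, and subtracting \<open>f\<close> leaves 1.\<close>

lemma sum_W_tilde_row:
  fixes W :: "real ^ 'n ^ 'm"
  assumes "stochastic W" and "entry_sum r < 1"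
  shows "(\<Sum>j\<in>UNIV. W_tilde W r f $ i $ j) = 1"
proof -
  let ?A = "mat 1 - ones_times r :: real ^ 'm ^ 'm"
  have "(\<Sum>j\<in>UNIV. (?A ** W) $ i $ j) = (\<Sum>l\<in>UNIV. ?A $ i $ l * (\<Sum>j\<in>UNIV. W $ l $ j))"
    by (simp add: matrix_matrix_mult_def sum_distrib_left) (rule sum.swap)
  also have "\<dots> = (\<Sum>l\<in>UNIV. ?A $ i $ l)"
    using assms(1) by (simp add: stochastic_def)
  also have "\<dots> = 1 - entry_sum r"
    by (simp add: mat_def ones_times_def entry_sum_def sum_subtractf)
  finally have "(\<Sum>j\<in>UNIV. (?A ** W) $ i $ j) = 1 - entry_sum r" .
  then have "(\<Sum>j\<in>UNIV. W_tilde W r f $ i $ j)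
      = (1 + entry_sum f) / (1 - entry_sum r) * (1 - entry_sum r) - entry_sum f"
    by (simp add: W_tilde_def sum_subtractf ones_times_def[of f] entry_sum_def[of f]
        flip: sum_distrib_left sum_divide_distrib)
  then show ?thesis
    using assms(2) by simp
qed

text \<open>The \<open>i\<close>-th term is positive and all others are nonnegative. The denominator
  can be 0 only if column \<open>j\<close> of \<open>V\<close> vanishes, and then every later term
  containing it carries a factor 0.\<close>

lemma Phi_denominator_pos:
  fixes V :: "real ^ 'n ^ 'm"
  assumes "0 \<le> V" "0 \<le> f" "\<forall>i. 0 < q $ i" "V $ i $ j \<noteq> 0"
  shows "0 < f $ j + (\<Sum>l\<in>UNIV. q $ l * V $ l $ j)"
proof -
  have V: "0 \<le> V $ l $ j" for l
    using assms(1) by (simp add: less_eq_vec_def)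
  have "0 < (\<Sum>l\<in>UNIV. q $ l * V $ l $ j)"
    using V assms(3,4) by (intro sum_pos2[of _ i]) (auto simp: less_le)
  moreover have "0 \<le> f $ j"
    using assms(2) by (simp add: less_eq_vec_def)
  ultimately show ?thesis by simp
qed

text \<open>The factor \<open>V $ i $ j\<close> stays in front because a zero entry, where the
  logarithm degenerates, then makes both sides 0. For a positive entry, the constant inside the
  logarithm drops out of the derivative.\<close>

lemma has_derivative_ln_Phi:
  fixes V :: "real ^ 'n ^ 'm"
  assumes "0 \<le> V" "0 \<le> f" "\<forall>i. 0 < q $ i"
  shows "((\<lambda>p. V $ i $ j * ln (Phi V f p $ j $ i)) has_derivative
     (\<lambda>h. V $ i $ j * (h $ i / q $ i
        - (\<Sum>l\<in>UNIV. h $ l * V $ l $ j) / (f $ j + (\<Sum>l\<in>UNIV. q $ l * V $ l $ j))))) (at q)"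
proof (cases "V $ i $ j = 0")
  case True
  then show ?thesis by simp
next
  case False
  let ?D = "\<lambda>p. f $ j + (\<Sum>l\<in>UNIV. p $ l * V $ l $ j)"
  have D: "0 < ?D q"
    by (rule Phi_denominator_pos[OF assms False])
  have V: "0 < V $ i $ j"
    using False assms(1) by (auto simp: less_eq_vec_def less_le)
  have q: "0 < q $ i"
    using assms(3) by simp
  have coord: "((\<lambda>p. p $ l) has_derivative (\<lambda>h. h $ l)) (at q)" for l
    by (rule bounded_linear.has_derivative[OF bounded_linear_vec_nth has_derivative_ident])
  have dD: "(?D has_derivative (\<lambda>h. \<Sum>l\<in>UNIV. h $ l * V $ l $ j)) (at q)"
    by (auto intro!: derivative_eq_intros coord)
  have "((\<lambda>p. ln (p $ i * V $ i $ j / ?D p)) has_derivative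
     (\<lambda>h. h $ i / q $ i - (\<Sum>l\<in>UNIV. h $ l * V $ l $ j) / ?D q)) (at q)"
    using D V q
    by (auto intro!: derivative_eq_intros coord dD ext simp: divide_simps) (simp add: algebra_simps)
  then show ?thesis
    by (auto simp: Phi_def intro: has_derivative_mult_right)
qed

text \<open>The weight is an exponential, so its derivative is itself times a logarithmic
  derivative. The unit row sum gives \<open>h $ i / q $ i\<close> the coefficient 1.\<close>

lemma has_derivative_algIII_weight:
  fixes W :: "real ^ 'n ^ 'm" and r :: "real ^ 'm" and f :: "real ^ 'n"
  defines "V \<equiv> W_tilde W r f"
  assumes "0 \<le> V" "0 \<le> f" "\<forall>i. 0 < q $ i" and row: "(\<Sum>j\<in>UNIV. V $ i $ j) = 1"
  shows "((\<lambda>p. algIII_weight W r f p i) has_derivative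
     (\<lambda>h. algIII_weight W r f q i * (h $ i / q $ i
        - (\<Sum>j\<in>UNIV. V $ i $ j * (\<Sum>l\<in>UNIV. h $ l * V $ l $ j)
             / (f $ j + (\<Sum>l\<in>UNIV. q $ l * V $ l $ j)))))) (at q)"
proof -
  let ?D = "\<lambda>j. f $ j + (\<Sum>l\<in>UNIV. q $ l * V $ l $ j)"
  have "((\<lambda>p. c_vec W r f $ i + (\<Sum>j\<in>UNIV. V $ i $ j * ln (Phi V f p $ j $ i)))
     has_derivative (\<lambda>h. 0 + (\<Sum>j\<in>UNIV. V $ i $ j * (h $ i / q $ i
        - (\<Sum>l\<in>UNIV. h $ l * V $ l $ j) / ?D j)))) (at q)"
    by (intro has_derivative_add has_derivative_const has_derivative_sum
        has_derivative_ln_Phi assms(2-4))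
  moreover have "(\<Sum>j\<in>UNIV. V $ i $ j * (h $ i / q $ i - (\<Sum>l\<in>UNIV. h $ l * V $ l $ j) / ?D j))
      = (\<Sum>j\<in>UNIV. V $ i $ j) * (h $ i / q $ i)
        - (\<Sum>j\<in>UNIV. V $ i $ j * (\<Sum>l\<in>UNIV. h $ l * V $ l $ j) / ?D j)" for h
    by (simp add: right_diff_distrib sum_subtractf flip: sum_distrib_right sum_divide_distrib)
  ultimately have "((\<lambda>p. c_vec W r f $ i + (\<Sum>j\<in>UNIV. V $ i $ j * ln (Phi V f p $ j $ i)))
     has_derivative (\<lambda>h. h $ i / q $ i
        - (\<Sum>j\<in>UNIV. V $ i $ j * (\<Sum>l\<in>UNIV. h $ l * V $ l $ j) / ?D j))) (at q)"
    using row by simp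
  from has_derivative_exp[OF this] show ?thesis
    by (simp add: algIII_weight_def V_def[symmetric] mult.commute)
qed

text \<open>The normalizer is the reciprocal of the total weight, since all maxima are then attained
  by their second argument. The point \<open>p\<close> is arbitrary because partial derivatives
  leave the simplex.\<close>

lemma algIII_map_interior:
  assumes "\<And>i. r $ i < algIII_weight W r f p i / (\<Sum>l\<in>UNIV. algIII_weight W r f p l)"
  shows "algIII_map W r f p $ i
     = algIII_weight W r f p i / (\<Sum>l\<in>UNIV. algIII_weight W r f p l)"
proof -
  define w where "w = algIII_weight W r f p"
  define S where "S = sum w UNIV"
  have w: "0 < w i" for i
    by (simp add: w_def algIII_weight_def)
  have S: "0 < S"
    unfolding S_def by (intro sum_pos) (auto simp: w)
  have r: "r $ i < w i / S" for i
    using assms by (simp add: w_def S_def)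
  have "algIII_alpha W r f p = 1 / S"
    unfolding algIII_alpha_def w_def[symmetric]
  proof (rule the_equality, intro conjI)
    have "(\<Sum>i\<in>UNIV. max (r $ i) (1 / S * w i)) = (\<Sum>i\<in>UNIV. w i / S)"
      using r by (intro sum.cong) (auto simp: max_def less_le_not_le)
    also have "\<dots> = 1"
      using S by (simp add: S_def flip: sum_divide_distrib)
    finally show "(\<Sum>i\<in>UNIV. max (r $ i) (1 / S * w i)) = 1" .
  next
    fix a assume a: "0 < a \<and> (\<Sum>i\<in>UNIV. max (r $ i) (a * w i)) = 1"
    \<comment> \<open>Uniqueness: bounding each maximum below by its second argument gives
      \<open>a * S \<le> 1\<close>.\<close>
    have "a * S \<le> (\<Sum>i\<in>UNIV. max (r $ i) (a * w i))"
      by (simp add: S_def sum_distrib_left sum_mono)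
    then have "a * S \<le> 1" using a by simp
    moreover have "\<not> a * S < 1"
    proof
      assume "a * S < 1"
      then have "a * w i < w i / S" for i
        using w[of i] S by (simp add: field_simps)
      \<comment> \<open>Both arguments of each maximum now lie strictly below
        \<open>w i / S\<close>.\<close>
      then have "(\<Sum>i\<in>UNIV. max (r $ i) (a * w i)) < (\<Sum>i\<in>UNIV. w i / S)"
        using r by (intro sum_strict_mono) auto
      also have "\<dots> = 1"
        using S by (simp add: S_def flip: sum_divide_distrib)
      finally show False using a by simp
    qed
    ultimately show "a = 1 / S"
      using S by (simp add: field_simps)
  qed (use S in simp)
  then show ?thesis
    using r[of i] by (simp add: algIII_map_def w_def S_def)
qed

text \<open>Cross-multiplication eliminates the normalizer, so neither its existence nor its
  continuity enters. Only the weights have to be continuous at \<open>q\<close>.\<close>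

lemma algIII_limit_eq_normalized_weight:
  assumes seq: "algIII_sequence W r f p" and lim: "p \<longlonglongrightarrow> q" and "entry_sum q = 1"
    and gt: "\<And>i. r $ i < q $ i" and cont: "\<And>i. isCont (\<lambda>p. algIII_weight W r f p i) q"
  shows "algIII_weight W r f q i / (\<Sum>l\<in>UNIV. algIII_weight W r f q l) = q $ i"
proof -
  define w where "w = algIII_weight W r f"
  have S: "0 < sum (w x) UNIV" for x
    by (intro sum_pos) (auto simp: w_def algIII_weight_def)
  have limS: "(\<lambda>t. p (Suc t)) \<longlonglongrightarrow> q"
    using lim by (rule LIMSEQ_Suc)
  have limw: "(\<lambda>t. w (p t) l) \<longlonglongrightarrow> w q l" for l
    using isCont_tendsto_compose[OF cont lim] by (simp add: w_def)
  \<comment> \<open>Strictly above \<open>r\<close>, an iterate must come from the second argument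
    of the maximum, hence is proportional to the weights at the preceding iterate.\<close>
  have "\<forall>\<^sub>F t in sequentially. \<forall>l. r $ l < p (Suc t) $ l"
    by (intro eventually_all_finite order_tendstoD(1)[OF tendsto_vec_nth[OF limS]] gt)
  then have eq: "\<forall>\<^sub>F t in sequentially.
      p (Suc t) $ i * sum (w (p t)) UNIV = entry_sum (p (Suc t)) * w (p t) i"
  proof eventually_elim
    case (elim t)
    let ?a = "algIII_alpha W r f (p t)"
    have "p (Suc t) $ l = max (r $ l) (?a * w (p t) l)" for l
      using seq by (simp add: algIII_sequence_def algIII_map_def w_def)
    then have "p (Suc t) $ l = ?a * w (p t) l" for l
      using elim[rule_format, of l] by (auto simp: max_def split: if_splits)
    then show ?case
      by (simp add: entry_sum_def flip: sum_distrib_left)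
  qed
  have "(\<lambda>t. p (Suc t) $ i * sum (w (p t)) UNIV) \<longlonglongrightarrow> q $ i * sum (w q) UNIV"
    by (intro tendsto_intros limS limw)
  then have "(\<lambda>t. entry_sum (p (Suc t)) * w (p t) i) \<longlonglongrightarrow> q $ i * sum (w q) UNIV"
    using eq by (rule Lim_transform_eventually)
  moreover have "(\<lambda>t. entry_sum (p (Suc t)) * w (p t) i) \<longlonglongrightarrow> entry_sum q * w q i"
    unfolding entry_sum_def by (intro tendsto_intros limS limw)
  ultimately have "q $ i * sum (w q) UNIV = entry_sum q * w q i"
    by (rule LIMSEQ_unique)
  then show ?thesis
    using S[of q] \<open>entry_sum q = 1\<close> by (simp add: w_def field_simps)
qed

text \<open>Differentiability is part of the conclusion because \<open>deriv\<close> is total: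
  without it the matrix equation could concern an arbitrary value.\<close>

theorem theorem2:
  fixes W :: "real ^ 'n ^ 'm" and r :: "real ^ 'm" and f :: "real ^ 'n"
    and p :: "nat \<Rightarrow> real ^ 'm" and q :: "real ^ 'm"
  assumes "stochastic W"
    and "\<exists>i i'. W $ i \<noteq> W $ i'"
    and "\<forall>j. column j W \<noteq> 0"
    and "admissible_pair W r f"
    and "algIII_sequence W r f p"
    and "p \<longlonglongrightarrow> q"
    and "q \<in> prob_simplex_above r"
    and "\<forall>i. r $ i < q $ i"
  shows "(\<forall>k i. coord_line (algIII_map W r f) q k i differentiable (at 0)) \<and>
         rate_matrix (algIII_map W r f) q
           = mat 1 - W_tilde W r f ** Psi (W_tilde W r f) f q"
proof -
  define V where "V = W_tilde W r f"
  define w where "w = algIII_weight W r f"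
  define S where "S = (\<lambda>x. \<Sum>l\<in>UNIV. w x l)"
  define D where "D = (\<lambda>j. f $ j + (\<Sum>l\<in>UNIV. q $ l * V $ l $ j))"
  \<comment> \<open>\<open>g i\<close> is the logarithmic derivative of the weight
    \<open>w x i\<close> at \<open>q\<close>.\<close>
  define g where "g = (\<lambda>i h. h $ i / q $ i
    - (\<Sum>j\<in>UNIV. V $ i $ j * (\<Sum>l\<in>UNIV. h $ l * V $ l $ j) / D j))"
  have V: "0 \<le> V" and f: "0 \<le> f" and r: "0 \<le> r" and "entry_sum r < 1"
    using assms(4) by (auto simp: admissible_pair_def V_def)
  then have row: "(\<Sum>j\<in>UNIV. V $ i $ j) = 1" for i
    unfolding V_def using sum_W_tilde_row assms(1) by blast
  have "0 \<le> r $ i" for i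
    using r by (simp add: less_eq_vec_def)
  then have q: "\<forall>i. 0 < q $ i"
    using assms(8) by (meson le_less_trans)
  have sumq: "entry_sum q = 1"
    using assms(7) by (simp add: prob_simplex_above_def prob_simplex_def)
  have S: "0 < S x" for x
    unfolding S_def by (intro sum_pos) (auto simp: w_def algIII_weight_def)
  have dw: "((\<lambda>x. w x i) has_derivative (\<lambda>h. w q i * g i h)) (at q)" for i
    unfolding w_def g_def D_def V_def
    by (rule has_derivative_algIII_weight) (use V f q row in \<open>auto simp: V_def\<close>)
  then have dS: "(S has_derivative (\<lambda>h. \<Sum>l\<in>UNIV. w q l * g l h)) (at q)"
    unfolding S_def by (rule has_derivative_sum)
  have contw: "isCont (\<lambda>x. w x i) q" for i
    by (rule has_derivative_continuous[OF dw])
  have fixp: "w q i / S q = q $ i" for i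
    unfolding w_def S_def
    by (rule algIII_limit_eq_normalized_weight[OF assms(5,6) sumq])
      (use assms(8) contw in \<open>auto simp: w_def\<close>)
  \<comment> \<open>Normalizing the weights subtracts from each logarithmic derivative the mean of
    all of them under \<open>q\<close>.\<close>
  have dM: "((\<lambda>x. algIII_map W r f x $ i) has_derivative
      (\<lambda>h. q $ i * (g i h - (\<Sum>l\<in>UNIV. q $ l * g l h)))) (at q)" for i
  proof -
    have "((\<lambda>x. w x l / S x) \<longlongrightarrow> q $ l) (at q)" for l
      using isCont_divide[OF contw[of l] has_derivative_continuous[OF dS]] S[of q] fixp[of l]
      by (simp add: continuous_within)
    then have "\<forall>\<^sub>F x in at q. \<forall>l. r $ l < w x l / S x"
      using assms(8) by (intro eventually_all_finite order_tendstoD(1)) auto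
    then have ev: "\<forall>\<^sub>F x in at q. w x i / S x = algIII_map W r f x $ i"
      by eventually_elim (simp add: w_def S_def algIII_map_interior)
    \<comment> \<open>The filter \<open>at q\<close> omits \<open>q\<close> itself, so transferring
      the derivative also needs agreement at the point.\<close>
    have "w q i / S q = algIII_map W r f q $ i"
      using assms(8) fixp by (simp add: w_def S_def algIII_map_interior)
    have "((\<lambda>x. w x i / S x) has_derivative
        (\<lambda>h. (w q i * g i h * S q - w q i * (\<Sum>l\<in>UNIV. w q l * g l h)) / (S q * S q))) (at q)"
      using S[of q] by (intro has_derivative_divide' dw dS) simp
    moreover have "(\<Sum>l\<in>UNIV. q $ l * g l h) = (\<Sum>l\<in>UNIV. w q l * g l h) / S q" for h
      by (simp add: sum_divide_distrib flip: fixp)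
    then have "(w q i * g i h * S q - w q i * (\<Sum>l\<in>UNIV. w q l * g l h)) / (S q * S q)
        = q $ i * (g i h - (\<Sum>l\<in>UNIV. q $ l * g l h))" for h
      using S[of q] by (simp add: field_simps flip: fixp[of i])
    ultimately show ?thesis
      using has_derivative_transform_eventually[OF _ ev] \<open>w q i / S q = algIII_map W r f q $ i\<close>
      by simp
  qed
  have gaxis: "g i (axis k 1) = (if i = k then 1 / q $ i else 0)
      - (\<Sum>j\<in>UNIV. V $ i $ j * V $ k $ j / D j)" for i k
    by (simp add: g_def axis_def if_distrib[of "\<lambda>x. x * _"] cong: if_cong)
  have entry: "q $ i * (g i (axis k 1) - (\<Sum>l\<in>UNIV. q $ l * g l (axis k 1)))
      = (mat 1 - V ** Psi V f q) $ k $ i" for i k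
  proof -
    \<comment> \<open>The diagonal term contributes \<open>q $ k * (1 / q $ k) = 1\<close>; it will
      cancel against the row sum of \<open>V\<close>.\<close>
    have "(\<Sum>l\<in>UNIV. q $ l * g l (axis k 1))
        = (\<Sum>l\<in>UNIV. if l = k then 1 else 0)
          - (\<Sum>l\<in>UNIV. \<Sum>j\<in>UNIV. q $ l * V $ l $ j * V $ k $ j / D j)"
      unfolding sum_subtractf[symmetric]
      by (intro sum.cong)
        (use q in \<open>auto simp: gaxis right_diff_distrib sum_distrib_left less_le mult.assoc\<close>)
    \<comment> \<open>After the swap, the inner sum over \<open>l\<close> is the denominator without
      \<open>f $ j\<close>. What finally remains of the mean is the \<open>k\<close>-th entry of
      \<open>V\<close> applied to \<open>Phi0\<close>.\<close>
    also have "(\<Sum>l\<in>UNIV. \<Sum>j\<in>UNIV. q $ l * V $ l $ j * V $ k $ j / D j)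
        = (\<Sum>j\<in>UNIV. V $ k $ j * (D j - f $ j) / D j)"
      by (subst sum.swap) (simp add: D_def sum_distrib_left sum_divide_distrib mult.commute)
    also have "\<dots> = (\<Sum>j\<in>UNIV. V $ k $ j - V $ k $ j * f $ j / D j)"
    proof (rule sum.cong)
      fix j
      show "V $ k $ j * (D j - f $ j) / D j = V $ k $ j - V $ k $ j * f $ j / D j"
      proof (cases "V $ k $ j = 0")
        case False
        then have "0 < D j"
          unfolding D_def by (rule Phi_denominator_pos[OF V f q])
        then show ?thesis by (simp add: field_simps)
      qed simp
    qed simp
    also have "\<dots> = 1 - (\<Sum>j\<in>UNIV. V $ k $ j * f $ j / D j)"
      by (simp add: sum_subtractf row)
    finally have sum: "(\<Sum>l\<in>UNIV. q $ l * g l (axis k 1)) = (\<Sum>j\<in>UNIV. V $ k $ j * f $ j / D j)"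
      by simp
    \<comment> \<open>The two summands of \<open>Psi\<close> match the two subtracted sums:
      \<open>Phi\<close> comes from \<open>g i\<close>, \<open>Phi0\<close> from the mean.\<close>
    have "(V ** Psi V f q) $ k $ i
        = (\<Sum>j\<in>UNIV. q $ i * (V $ i $ j * V $ k $ j / D j) + q $ i * (V $ k $ j * f $ j / D j))"
      by (simp add: matrix_matrix_mult_def Psi_def Phi_def Phi0_def D_def distrib_left mult_ac)
    also have "\<dots> = q $ i * (\<Sum>j\<in>UNIV. V $ i $ j * V $ k $ j / D j)
        + q $ i * (\<Sum>j\<in>UNIV. V $ k $ j * f $ j / D j)"
      by (simp add: sum.distrib sum_distrib_left)
    finally show ?thesis
      using q[rule_format, of i] unfolding sum by (auto simp: gaxis mat_def right_diff_distrib)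
  qed
  have DERIV: "(coord_line (algIII_map W r f) q k i has_real_derivative
      (mat 1 - V ** Psi V f q) $ k $ i) (at 0)" for k i
  proof -
    have "((\<lambda>t. q + t *\<^sub>R axis k 1) has_derivative (\<lambda>t. t *\<^sub>R axis k 1)) (at (0::real))"
      by (auto intro!: derivative_eq_intros)
    from has_derivative_compose[OF this, of "\<lambda>x. algIII_map W r f x $ i"] dM[of i]
    have "(coord_line (algIII_map W r f) q k i has_derivative
        (\<lambda>t. q $ i * (g i (t *\<^sub>R axis k 1) - (\<Sum>l\<in>UNIV. q $ l * g l (t *\<^sub>R axis k 1))))) (at 0)"
      by (simp add: coord_line_def)
    \<comment> \<open>Homogeneity of \<open>g l\<close> pulls \<open>t\<close> out and turns the
      chain rule along the line into a real derivative.\<close>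
    moreover have "g l (t *\<^sub>R axis k 1) = t * g l (axis k 1)" for l t
      by (simp add: g_def right_diff_distrib sum_distrib_left mult_ac)
    moreover have "(\<Sum>l\<in>UNIV. q $ l * (t * g l (axis k 1)))
        = t * (\<Sum>l\<in>UNIV. q $ l * g l (axis k 1))" for t
      by (simp add: sum_distrib_left mult_ac)
    ultimately show ?thesis
      unfolding entry[symmetric] has_field_derivative_def
      by (simp add: mult_ac mult_commute_abs flip: right_diff_distrib)
  qed
  show ?thesis
    unfolding V_def[symmetric]
  proof (intro conjI allI)
    show "coord_line (algIII_map W r f) q k i differentiable (at 0)" for k i
      using DERIV real_differentiable_def by blast
    show "rate_matrix (algIII_map W r f) q = mat 1 - V ** Psi V f q"
      by (simp add: rate_matrix_def vec_eq_iff DERIV_imp_deriv[OF DERIV])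
  qed
qed

end
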